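(* For every integer $n \geq 3$, $\sigma(L(K_n)) = 2(n-2)$, where $L(K_n)$ is the line graph of the complete graph $K_n$.
   Context: Surrounding Cops and Robbers on a finite simple graph $G$ with $k \geq 1$ cops and one robber: the cops first choose starting vertices (several cops may share a vertex), then the robber chooses a starting vertex not occupied by a cop, and thereafter the cops and the robber alternate moves, the cops moving first. In a move, each player may move to an adjacent vertex or stay put; the robber may never move to, or remain on, a vertex occupied by a cop, so if a cop moves onto the robber's vertex the robber is compelled to move to a neighbouring vertex not occupied by a cop. The cops win if at any time every neighbour of the robber's vertex is occupied by a cop; the robber wins if he avoids this forever. Play is with perfect information. The surrounding cop number $\sigma(G)$ is the least number of cops for which the cops have a winning strategy. The line graph $L(G)$ has vertex set $E(G)$, two edges being adjacent in $L(G)$ if they share an endpoint in $G$. *)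

theory Defs
  imports Main
begin

record 'a graph =
  verts :: "'a set"
  edges :: "'a set set"

definition finite_simple_graph :: "'a graph \<Rightarrow> bool" where
  "finite_simple_graph G \<longleftrightarrow> finite (verts G) \<and> (\<forall>e \<in> edges G. e \<subseteq> verts G \<and> card e = 2)"

definition nbrs :: "'a graph \<Rightarrow> 'a \<Rightarrow> 'a set" where
  "nbrs G v = {w \<in> verts G. {v, w} \<in> edges G}"

definition complete_graph :: "nat \<Rightarrow> nat graph" where
  "complete_graph n = \<lparr> verts = {..<n}, edges = {e. e \<subseteq> {..<n} \<and> card e = 2} \<rparr>"

definition line_graph :: "'a graph \<Rightarrow> 'a set graph" where
  "line_graph G = \<lparr> verts = edges G,
     edges = {{e, f} | e f. e \<in> edges G \<and> f \<in> edges G \<and> e \<noteq> f \<and> e \<inter> f \<noteq> {}} \<rparr>"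

lemma finite_simple_complete_graph: "finite_simple_graph (complete_graph n)"
  by (auto simp: finite_simple_graph_def complete_graph_def)

lemma finite_simple_line_graph:
  assumes "finite_simple_graph G"
  shows "finite_simple_graph (line_graph G)"
proof -
  have "edges G \<subseteq> Pow (verts G)" and "finite (verts G)"
    using assms by (auto simp: finite_simple_graph_def)
  then have "finite (edges G)"
    by (meson finite_Pow_iff finite_subset)
  moreover have "d \<subseteq> edges G \<and> card d = 2" if d: "d \<in> edges (line_graph G)" for d
  proof -
    obtain e f where "d = {e, f}" "e \<in> edges G" "f \<in> edges G" "e \<noteq> f"
      using d unfolding line_graph_def by auto
    then show ?thesis
      by (simp add: card_insert_if)
  qed
  ultimately show ?thesis
    by (simp add: finite_simple_graph_def) (simp add: line_graph_def)
qed

text \<open>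
  A configuration of the cops \<open>0, \<dots>, k - 1\<close> is a function \<open>C\<close> of which only the values
  at \<open>i < k\<close> matter; several cops may share a vertex.
\<close>

definition occupied :: "nat \<Rightarrow> (nat \<Rightarrow> 'a) \<Rightarrow> 'a set" where
  "occupied k C = C ` {..<k}"

definition may_move :: "'a graph \<Rightarrow> 'a \<Rightarrow> 'a \<Rightarrow> bool" where
  "may_move G v w \<longleftrightarrow> w = v \<or> w \<in> nbrs G v"

definition surrounded :: "'a graph \<Rightarrow> nat \<Rightarrow> (nat \<Rightarrow> 'a) \<Rightarrow> 'a \<Rightarrow> bool" where
  "surrounded G k C v \<longleftrightarrow> nbrs G v \<subseteq> occupied k C"

text \<open>
  A strategy of the cops maps the list of all positions the robber has held so far to the next
  configuration of the cops; its value at \<open>[]\<close> is the initial placement. The earlier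
  configurations of the cops are determined by the strategy and the robber's earlier positions,
  so they need not be arguments. Legality is demanded on all lists of vertices, which is no
  restriction because on lists that cannot arise the cops may stay put.
\<close>

definition cop_strategy :: "'a graph \<Rightarrow> nat \<Rightarrow> ('a list \<Rightarrow> nat \<Rightarrow> 'a) \<Rightarrow> bool" where
  "cop_strategy G k S \<longleftrightarrow>
     (\<forall>i<k. S [] i \<in> verts G) \<and>
     (\<forall>h v. set (h @ [v]) \<subseteq> verts G \<longrightarrow> (\<forall>i<k. may_move G (S h i) (S (h @ [v]) i)))"

text \<open>
  In round \<open>t\<close> the cops following \<open>S\<close> take the configuration \<open>cops_at S r t\<close>, and then the
  robber takes the vertex \<open>r t\<close>; round \<open>0\<close> is the placement.
\<close>

definition cops_at :: "('a list \<Rightarrow> nat \<Rightarrow> 'a) \<Rightarrow> (nat \<Rightarrow> 'a) \<Rightarrow> nat \<Rightarrow> nat \<Rightarrow> 'a" where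
  "cops_at S r t = S (map r [0..<t])"

definition robber_play :: "'a graph \<Rightarrow> nat \<Rightarrow> ('a list \<Rightarrow> nat \<Rightarrow> 'a) \<Rightarrow> (nat \<Rightarrow> 'a) \<Rightarrow> bool" where
  "robber_play G k S r \<longleftrightarrow>
     r 0 \<in> verts G \<and>
     (\<forall>t. may_move G (r t) (r (Suc t))) \<and>
     (\<forall>t. r t \<notin> occupied k (cops_at S r t))"

text \<open>
  The robber wins an infinite play in which he is surrounded neither after a move of his own (or
  his placement) nor after a move of the cops. A robber without a legal move stands on a vertex
  with a cop and with all neighbours occupied, so he is already surrounded; hence quantifying over
  infinite plays loses nothing. If the cops occupy every vertex at the start, the robber has no
  play and the cops win.
\<close>

definition robber_evades :: "'a graph \<Rightarrow> nat \<Rightarrow> ('a list \<Rightarrow> nat \<Rightarrow> 'a) \<Rightarrow> (nat \<Rightarrow> 'a) \<Rightarrow> bool" where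
  "robber_evades G k S r \<longleftrightarrow>
     robber_play G k S r \<and>
     (\<forall>t. \<not> surrounded G k (cops_at S r t) (r t) \<and>
          \<not> surrounded G k (cops_at S r (Suc t)) (r t))"

definition cops_win :: "'a graph \<Rightarrow> nat \<Rightarrow> bool" where
  "cops_win G k \<longleftrightarrow> (\<exists>S. cop_strategy G k S \<and> \<not> (\<exists>r. robber_evades G k S r))"

definition surrounding_cop_number :: "'a graph \<Rightarrow> nat" where
  "surrounding_cop_number G = (LEAST k. 1 \<le> k \<and> cops_win G k)"

end

theory Submission
  imports Defs
begin

text \<open>
  Every vertex of \<open>L(K\<^sub>n)\<close> has degree \<open>2(n - 2)\<close>. With fewer cops the robber always has a
  neighbouring vertex without a cop, so he can move forever and is never surrounded.

  Conversely, \<open>2(n - 2)\<close> cops start on the edges \<open>0x\<close> and \<open>1x\<close> with \<open>x \<ge> 2\<close>. A robber starting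
  on \<open>01\<close> is surrounded at once. Otherwise he starts on some \<open>ab\<close> with \<open>a, b \<ge> 2\<close>, and the cops
  surround him in one move: those on \<open>0a, 1a, 0b, 1b\<close> stay, and for every other \<open>x\<close> the cops
  on \<open>0x\<close> and \<open>1x\<close> move to \<open>ax\<close> and \<open>bx\<close>.
\<close>

text \<open>At most \<open>k\<close> vertices are occupied, fewer than any vertex has neighbours, so
  a free neighbour always exists. The robber's play must be built against a fixed \<open>S\<close>,
  which may react to all his earlier positions.\<close>

lemma not_cops_win_less_degree:
  assumes v: "v \<in> verts G" and deg: "\<And>u. u \<in> verts G \<Longrightarrow> k < card (nbrs G u)"
  shows "\<not> cops_win G k"
proof
  assume "cops_win G k"
  then obtain S where S: "\<nexists>r. robber_evades G k S r"
    by (auto simp: cops_win_def)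
  have not_surrounded: "\<not> surrounded G k C u" if "u \<in> verts G" for C u
  proof
    assume "surrounded G k C u"
    then have "card (nbrs G u) \<le> card (occupied k C)"
      by (auto simp: surrounded_def occupied_def intro!: card_mono)
    also have "\<dots> \<le> k"
      unfolding occupied_def using card_image_le[of "{..<k}" C] by simp
    finally show False
      using deg[OF that] by simp
  qed
  \<comment> \<open>Prepending \<open>v\<close> gives the robber a fictitious position before the
    game, so that his placement is also a step to a free neighbour and needs no separate
    case.\<close>
  define next_pos where
    "next_pos h = (SOME w. w \<in> nbrs G (last (v # h)) \<and> w \<notin> occupied k (S h))" for h
  \<comment> \<open>Since \<open>S\<close> reads the whole history, the recursion runs over
    histories, and \<open>r\<close> is read off afterwards.\<close>
  define hist where "hist = rec_nat [] (\<lambda>_ h. h @ [next_pos h])"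
  define r where "r t = next_pos (hist t)" for t
  have hist_simps [simp]: "hist 0 = []" "hist (Suc t) = hist t @ [r t]" for t
    by (simp_all add: hist_def r_def)
  have hist: "map r [0..<t] = hist t" for t
    by (induction t) auto
  have next_pos: "next_pos h \<in> nbrs G (last (v # h)) \<and> next_pos h \<notin> occupied k (S h)"
    if "last (v # h) \<in> verts G" for h
  proof -
    have "\<exists>w. w \<in> nbrs G (last (v # h)) \<and> w \<notin> occupied k (S h)"
      using not_surrounded[OF that, of "S h"] by (auto simp: surrounded_def)
    then show ?thesis
      unfolding next_pos_def by (rule someI_ex)
  qed
  have last_in: "last (v # hist t) \<in> verts G" for t
  proof (induction t)
    case (Suc t)
    then show ?case
      using next_pos[of "hist t"] by (simp add: nbrs_def r_def)
  qed (simp add: v)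
  have r: "r t \<in> nbrs G (last (v # hist t))" "r t \<notin> occupied k (S (hist t))" for t
    using next_pos[OF last_in, of t] by (simp_all add: r_def)
  have r_in: "r t \<in> verts G" for t
    using r(1)[of t] by (simp add: nbrs_def)
  have "may_move G (r t) (r (Suc t))" for t
    using r(1)[of "Suc t"] by (simp add: may_move_def)
  then have "robber_evades G k S r"
    using r_in r(2) not_surrounded
    by (simp add: robber_evades_def robber_play_def cops_at_def hist del: upt_Suc)
  then show False
    using S by blast
qed

lemma nbrs_line_graph:
  assumes "e \<in> edges G"
  shows "nbrs (line_graph G) e = {f \<in> edges G. f \<noteq> e \<and> e \<inter> f \<noteq> {}}"
  using assms by (auto simp: nbrs_def line_graph_def doubleton_eq_iff)

lemma verts_line_graph_complete:
  "verts (line_graph (complete_graph n)) = {{a, b} | a b. a < b \<and> b < n}"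
proof -
  have "\<exists>a b. e = {a, b} \<and> a < b \<and> b < n" if "e \<subseteq> {..<n}" "card e = 2" for e :: "nat set"
  proof -
    obtain x y where "e = {x, y}" "x \<noteq> y"
      using \<open>card e = 2\<close> by (auto simp: card_2_iff)
    then have "e = {min x y, max x y}" "min x y < max x y" "max x y < n"
      using \<open>e \<subseteq> {..<n}\<close> by (auto simp: min_def max_def)
    then show ?thesis
      by blast
  qed
  then show ?thesis
    by (auto simp: line_graph_def complete_graph_def)
qed

lemma doubleton_in_verts_line_graph_complete:
  assumes "a < n" "b < n" "a \<noteq> b"
  shows "{a, b} \<in> verts (line_graph (complete_graph n))"
  using assms by (simp add: line_graph_def complete_graph_def)

text \<open>A neighbour keeps exactly one endpoint of \<open>{a, b}\<close>. The two images, by the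
  endpoint kept, are disjoint and of size \<open>n - 2\<close> each, which gives the degree.\<close>

lemma nbrs_line_graph_complete:
  assumes "a < n" "b < n" "a \<noteq> b"
  shows "nbrs (line_graph (complete_graph n)) {a, b} =
    (\<lambda>x. {a, x}) ` ({..<n} - {a, b}) \<union> (\<lambda>x. {b, x}) ` ({..<n} - {a, b})" (is "_ = ?R")
proof -
  have "{a, b} \<in> edges (complete_graph n)"
    using assms by (simp add: complete_graph_def)
  then have "nbrs (line_graph (complete_graph n)) {a, b} =
      {f. f \<subseteq> {..<n} \<and> card f = 2 \<and> f \<noteq> {a, b} \<and> {a, b} \<inter> f \<noteq> {}}"
    by (auto simp: nbrs_line_graph) (auto simp: complete_graph_def)
  also have "\<dots> = ?R"
  proof (intro equalityI subsetI)
    fix f assume "f \<in> {f. f \<subseteq> {..<n} \<and> card f = 2 \<and> f \<noteq> {a, b} \<and> {a, b} \<inter> f \<noteq> {}}"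
    then obtain x y where xy: "f = {x, y}" "x \<noteq> y" "x < n" "y < n" "{x, y} \<noteq> {a, b}"
        "x \<in> {a, b} \<or> y \<in> {a, b}"
      by (auto simp: card_2_iff)
    then consider "x = a" "y \<notin> {a, b}" | "x = b" "y \<notin> {a, b}"
      | "y = a" "x \<notin> {a, b}" | "y = b" "x \<notin> {a, b}"
      by (auto simp: doubleton_eq_iff)
    then show "f \<in> ?R"
      using xy by cases (auto simp: insert_commute)
  next
    fix f assume "f \<in> ?R"
    then show "f \<in> {f. f \<subseteq> {..<n} \<and> card f = 2 \<and> f \<noteq> {a, b} \<and> {a, b} \<inter> f \<noteq> {}}"
      using assms by (auto simp: card_insert_if doubleton_eq_iff)
  qed
  finally show ?thesis .
qed

lemma card_nbrs_line_graph_complete: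
  assumes "a < n" "b < n" "a \<noteq> b"
  shows "card (nbrs (line_graph (complete_graph n)) {a, b}) = 2 * (n - 2)"
proof -
  let ?X = "{..<n} - {a, b}"
  have inj: "inj_on (\<lambda>x. {c, x}) ?X" for c
    by (auto simp: inj_on_def doubleton_eq_iff)
  have "card ?X = n - 2"
    using assms by (subst card_Diff_subset) auto
  moreover have "(\<lambda>x. {a, x}) ` ?X \<inter> (\<lambda>x. {b, x}) ` ?X = {}"
    using assms by (auto simp: doubleton_eq_iff)
  ultimately show ?thesis
    using assms by (simp add: nbrs_line_graph_complete card_Un_disjoint card_image inj)
qed

lemma cops_win_line_graph_complete:
  assumes "n \<ge> 3"
  shows "cops_win (line_graph (complete_graph n)) (2 * (n - 2))"
proof -
  let ?L = "line_graph (complete_graph n)" and ?k = "2 * (n - 2)"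
  \<comment> \<open>The parity of \<open>i\<close> selects the endpoint 0 or 1, and the quotient
    selects the other endpoint, which runs over 2, ..., \<open>n - 1\<close> for
    \<open>i < 2 * (n - 2)\<close>.\<close>
  define start where "start i = {i mod 2, 2 + i div 2}" for i :: nat
  \<comment> \<open>\<open>Min\<close> and \<open>Max\<close> tell the two endpoints of
    \<open>v\<close> apart: even cops go to one, odd cops to the other. If \<open>v\<close> meets
    \<open>{0, 1}\<close>, it is either \<open>{0, 1}\<close>, already surrounded, or occupied at
    the start; staying put keeps the move legal.\<close>
  define target where "target v i =
    (if 2 + i div 2 \<in> v \<or> v \<inter> {0, 1} \<noteq> {} then start i
     else {if i mod 2 = 0 then Min v else Max v, 2 + i div 2})" for v and i :: nat
  \<comment> \<open>Only the robber's first position counts, so the cops stand still after their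
    first move.\<close>
  define S where "S h = (if h = [] then start else target (hd h))" for h
  have start_in: "start i \<in> verts ?L" if "i < ?k" for i
    unfolding start_def using that
    by (intro doubleton_in_verts_line_graph_complete) auto
  have move: "may_move ?L (start i) (target v i)" if v: "v \<in> verts ?L" and i: "i < ?k" for v i
  proof (cases "2 + i div 2 \<in> v \<or> v \<inter> {0, 1} \<noteq> {}")
    case False
    define x where "x = 2 + i div 2"
    obtain a b where ab: "v = {a, b}" "a < b" "b < n"
      using v by (auto simp: verts_line_graph_complete)
    have neq: "a \<noteq> i mod 2" "b \<noteq> i mod 2" "a \<noteq> x" "b \<noteq> x"
      using False ab by (auto simp: x_def)
    have x: "x < n" "i mod 2 < n" "i mod 2 \<noteq> x"
      using i assms by (auto simp: x_def)
    \<comment> \<open>The cop keeps the endpoint \<open>x\<close> and exchanges the other one, hence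
      moves along an edge of the line graph.\<close>
    have "target v i = {x, if i mod 2 = 0 then a else b}"
      using False ab by (simp add: target_def x_def insert_commute)
    moreover have "start i = {i mod 2, x}"
      by (simp add: start_def x_def)
    ultimately show ?thesis
      using neq x ab by (auto simp: may_move_def nbrs_line_graph_complete)
  qed (simp add: target_def may_move_def)
  have "cop_strategy ?L ?k S"
    unfolding cop_strategy_def
  proof (intro conjI allI impI)
    fix h v i assume "set (h @ [v]) \<subseteq> verts ?L" "i < ?k"
    then show "may_move ?L (S h i) (S (h @ [v]) i)"
      by (cases "h = []") (simp_all add: S_def move, simp add: may_move_def)
  qed (simp add: S_def start_in)
  moreover have False if evades: "robber_evades ?L ?k S r" for r
  proof -
    \<comment> \<open>Round 0 suffices: \<open>ns0\<close> is the situation after the placement,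
      \<open>ns1\<close> the one after the first move of the cops.\<close>
    have r0: "r 0 \<in> verts ?L" "r 0 \<notin> start ` {..<?k}"
      and ns0: "\<not> nbrs ?L (r 0) \<subseteq> start ` {..<?k}"
      and ns1: "\<not> nbrs ?L (r 0) \<subseteq> target (r 0) ` {..<?k}"
      using evades unfolding robber_evades_def robber_play_def surrounded_def occupied_def cops_at_def
      by (auto simp: S_def dest!: spec[of _ 0])
    obtain a b where ab: "r 0 = {a, b}" "a < b" "b < n"
      using r0(1) by (auto simp: verts_line_graph_complete)
    \<comment> \<open>The index \<open>2 * (x - 2) + j\<close> inverts the numbering used in
      \<open>start\<close>.\<close>
    have start: "{j, x} \<in> start ` {..<?k}" if "j < 2" "2 \<le> x" "x < n" for j x
      using that by (intro image_eqI[of _ _ "2 * (x - 2) + j"]) (auto simp: start_def)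
    show False
    proof (cases "a < 2")
      case True
      then have "b < 2"
        using start[of a b] r0(2) ab by force
      then have "a = 0" "b = 1"
        using \<open>a < b\<close> by auto
      then have "nbrs ?L (r 0) \<subseteq> start ` {..<?k}"
        using ab start by (auto simp: nbrs_line_graph_complete)
      then show False
        using ns0 by simp
    next
      case False
      have target: "target (r 0) (2 * (x - 2) + j) \<in> target (r 0) ` {..<?k}"
        if "j < 2" "2 \<le> x" "x < n" for j x
        using that by (intro imageI) auto
      \<comment> \<open>These are the cops whose endpoint \<open>c\<close> already lies on the
        robber's edge.\<close>
      have stay: "{c, j} \<in> target (r 0) ` {..<?k}" if "c = a \<or> c = b" "j < 2" for c j
      proof -
        have "2 \<le> c" "Suc (Suc (c - 2)) = c" "c < n" "c \<in> r 0"
          using that ab False by auto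
        moreover from this have "target (r 0) (2 * (c - 2) + j) = {j, c}"
          using \<open>j < 2\<close> by (simp add: target_def start_def)
        ultimately show ?thesis
          using target[of j c] \<open>j < 2\<close> by (simp add: insert_commute)
      qed
      \<comment> \<open>The even and the odd cop with endpoint \<open>x\<close> part: one takes
        \<open>a\<close>, the minimum, the other \<open>b\<close>, the maximum.\<close>
      have approach: "{a, x} \<in> target (r 0) ` {..<?k}" "{b, x} \<in> target (r 0) ` {..<?k}"
        if "x \<noteq> a" "x \<noteq> b" "2 \<le> x" "x < n" for x
      proof -
        have "Suc (Suc (x - 2)) = x"
          using \<open>2 \<le> x\<close> by simp
        then have "target (r 0) (2 * (x - 2) + 0) = {a, x}"
            "target (r 0) (2 * (x - 2) + 1) = {b, x}"
          using that ab False by (simp_all add: target_def)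
        then show "{a, x} \<in> target (r 0) ` {..<?k}" "{b, x} \<in> target (r 0) ` {..<?k}"
          using target[of 0 x] target[of 1 x] that by simp_all
      qed
      have "{c, x} \<in> target (r 0) ` {..<?k}"
        if "c = a \<or> c = b" "x \<noteq> a" "x \<noteq> b" "x < n" for c x
        using stay[of c x] approach[of x] that by (cases "x < 2") auto
      then have "nbrs ?L (r 0) \<subseteq> target (r 0) ` {..<?k}"
        using ab by (auto simp: nbrs_line_graph_complete)
      then show False
        using ns1 by simp
    qed
  qed
  ultimately show ?thesis
    by (auto simp: cops_win_def)
qed

theorem theorem11:
  fixes n :: nat
  assumes "n \<ge> 3"
  shows "surrounding_cop_number (line_graph (complete_graph n)) = 2 * (n - 2)"
  unfolding surrounding_cop_number_def
proof (rule Least_equality)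
  show "1 \<le> 2 * (n - 2) \<and> cops_win (line_graph (complete_graph n)) (2 * (n - 2))"
    using assms cops_win_line_graph_complete by simp
next
  fix k assume k: "1 \<le> k \<and> cops_win (line_graph (complete_graph n)) k"
  show "2 * (n - 2) \<le> k"
  proof (rule ccontr)
    assume "\<not> 2 * (n - 2) \<le> k"
    then have "\<not> cops_win (line_graph (complete_graph n)) k"
      using assms
      by (intro not_cops_win_less_degree[of "{0, 1}"])
        (auto simp: doubleton_in_verts_line_graph_complete,
         auto simp: verts_line_graph_complete card_nbrs_line_graph_complete)
    then show False
      using k by simp
  qed
qed

end
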